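(* For every integer $t\geq 5$ and every positive integer $k$, \[ \mathrm{LCS}_2(t,\mathcal{P}_k)\geq\left(\tfrac{7}{4}-\tfrac{8}{t}\right)^{1/6}k^{1/3}-2. \]
   Context: $\mathcal{P}_k$ is the set of permutations on $k$ letters, viewed as words over $\{1,\dots,k\}$ in which each letter occurs exactly once. $\mathrm{LCS}(w,w')$ is the length of a longest common subsequence of words $w,w'$. $\mathrm{LCS}_2(t,\mathcal P_k)$ is the minimum, over all sets of $t$ distinct permutations in $\mathcal P_k$, of the maximum of $\mathrm{LCS}(\pi,\pi')$ over pairs of distinct $\pi,\pi'$ in the set. *)

theory Defs
  imports Complex_Main "HOL-Library.Sublist"
begin

definition perms_words :: "nat \<Rightarrow> nat list set" where
  "perms_words k = {w. distinct w \<and> set w = {1..k}}"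

definition LCS :: "'a list \<Rightarrow> 'a list \<Rightarrow> nat" where
  "LCS w w' = Max {length u | u. subseq u w \<and> subseq u w'}"

definition maxLCS :: "nat list set \<Rightarrow> nat" where
  "maxLCS S = Max {LCS p q | p q. p \<in> S \<and> q \<in> S \<and> p \<noteq> q}"

definition LCS2 :: "nat \<Rightarrow> nat \<Rightarrow> nat" where
  "LCS2 t k = Min {maxLCS S | S. S \<subseteq> perms_words k \<and> card S = t}"

end

theory Submission
  imports Defs "HOL-Combinatorics.Multiset_Permutations" "HOL-Analysis.Convex"
begin

text \<open>Give each letter \<open>x\<close> and each pair of permutations a label below \<open>L\<close>, the
  length of a longest common subsequence of the parts preceding \<open>x\<close>. The label increases
  whenever both permutations pass from \<open>x\<close> to \<open>y\<close>, so the three labels given by a triple of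
  permutations determine the letter, and at most about \<open>L^6/8\<close> pairs of letters are
  ordered the same way by all three labels. On the other hand, let \<open>x\<close> precede \<open>y\<close> in
  the permutations of \<open>A\<close> and follow it in those of \<open>B\<close>. All triples
  inside \<open>A\<close> or inside \<open>B\<close> order the labels consistently, and so do the triples
  formed by \<open>b \<in> B\<close> and two of its neighbours in \<open>A\<close>, or by \<open>a \<in> A\<close> and two of its neighbours
  in \<open>B\<close>, where the direction of the label of a pair \<open>a\<close>, \<open>b\<close> decides whether \<open>a\<close> counts as
  a neighbour of \<open>b\<close> or \<open>b\<close> as one of \<open>a\<close>. Cauchy--Schwarz for these degrees
  shows that about 7/16 of all triples are consistent, the worst case being that \<open>A\<close> and \<open>B\<close>
  have equal size.\<close>

section \<open>Labels of letters\<close>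

lemma finite_LCS_set: "finite {length u | u. subseq u w \<and> subseq u w'}"
proof (rule finite_subset)
  show "{length u | u. subseq u w \<and> subseq u w'} \<subseteq> {..length w}"
    by (auto dest: list_emb_length)
qed simp

lemma LCS_ge: "subseq u w \<Longrightarrow> subseq u w' \<Longrightarrow> length u \<le> LCS w w'"
  unfolding LCS_def by (rule Max_ge[OF finite_LCS_set]) blast

lemma LCS_attained: obtains u where "subseq u w" "subseq u w'" "length u = LCS w w'"
proof -
  have "LCS w w' \<in> {length u | u. subseq u w \<and> subseq u w'}"
    unfolding LCS_def by (rule Max_in[OF finite_LCS_set]) (auto intro: exI[of _ "[]"])
  then show ?thesis using that by auto
qed

lemma LCS_commute: "LCS w w' = LCS w' w"
  unfolding LCS_def by (simp add: conj_commute)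

text \<open>Membership \<open>x \<in> set (before p y)\<close> serves as the relation that x
  precedes y in p, so no positions in words are needed.\<close>

definition before :: "'a list \<Rightarrow> 'a \<Rightarrow> 'a list" where
  "before p x = takeWhile (\<lambda>z. z \<noteq> x) p"

lemma before_total:
  assumes "x \<in> set p" "y \<in> set p" "x \<noteq> y"
  shows "x \<in> set (before p y) \<or> y \<in> set (before p x)"
  using assms
proof (induction p)
  case (Cons a p)
  then show ?case by (cases "a = x"; cases "a = y") (simp_all add: before_def)
qed simp

lemma subseq_before_snoc: "x \<in> set p \<Longrightarrow> subseq (before p x @ [x]) p"
  unfolding before_def by (induction p) auto

lemma before_before: "x \<in> set (before p y) \<Longrightarrow> before (before p y) x = before p x"
  unfolding before_def by (induction p) (auto split: if_splits)

definition label :: "'a list \<Rightarrow> 'a list \<Rightarrow> 'a \<Rightarrow> nat" where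
  "label p q x = LCS (before p x) (before q x)"

lemma label_commute: "label p q x = label q p x"
  unfolding label_def by (rule LCS_commute)

text \<open>A common subsequence of the two prefixes can be extended by x itself. The strict bound
  matters: labels start at 0, so a pair of words has at most \<open>LCS p q\<close> label
  values.\<close>

lemma label_less_LCS:
  assumes "x \<in> set p" "x \<in> set q"
  shows "label p q x < LCS p q"
proof -
  obtain u where u: "subseq u (before p x)" "subseq u (before q x)" "length u = label p q x"
    unfolding label_def by (rule LCS_attained)
  have "subseq (u @ [x]) p" "subseq (u @ [x]) q"
    using u subseq_before_snoc assms subseq_order.trans
    by (metis list_emb_append_mono subseq_order.refl)+
  from LCS_ge[OF this] show ?thesis using u by simp
qed

text \<open>Cutting both words off before y does not change the label of x, so this is the preceding
  bound applied to the two prefixes.\<close>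

lemma label_less:
  assumes "x \<in> set (before p y)" "x \<in> set (before q y)"
  shows "label p q x < label p q y"
  using label_less_LCS[OF assms] assms by (simp add: label_def before_before)

text \<open>Two of any three words agree on the order of \<open>x\<close> and \<open>y\<close>.\<close>
lemma labels_inj:
  assumes "x \<in> set p" "y \<in> set p" "x \<in> set q" "y \<in> set q" "x \<in> set r" "y \<in> set r"
    and "label p q x = label p q y" "label p r x = label p r y" "label q r x = label q r y"
  shows "x = y"
proof (rule ccontr)
  assume "x \<noteq> y"
  then have "x \<in> set (before p y) \<or> y \<in> set (before p x)"
    "x \<in> set (before q y) \<or> y \<in> set (before q x)"
    "x \<in> set (before r y) \<or> y \<in> set (before r x)"
    using before_total assms(1-6) by metis+
  then show False
    using assms(7-9) label_less[of x _ y] label_less[of y _ x] by (metis less_irrefl)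
qed

section \<open>Counting monotone triples\<close>

definition monotone_triples :: "'b set \<Rightarrow> ('b \<Rightarrow> 'b \<Rightarrow> bool) \<Rightarrow> 'b set set" where
  "monotone_triples I R = {U. U \<subseteq> I \<and> card U = 3 \<and> (\<forall>i\<in>U. \<forall>j\<in>U. i \<noteq> j \<longrightarrow> R i j)}"

lemma finite_monotone_triples: "finite I \<Longrightarrow> finite (monotone_triples I R)"
  unfolding monotone_triples_def by (rule finite_subset[of _ "Pow I"]) auto

text \<open>Two disjoint families are counted: triples inside A, and triples made of one b outside A
  with two elements of \<open>N b\<close>. In the second family the pair from \<open>N b\<close> is
  related because it lies in A.\<close>

lemma card_monotone_triples_ge:
  assumes fin: "finite I" and "A \<subseteq> I"
    and sym: "\<And>i j. R i j \<Longrightarrow> R j i"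
    and RA: "\<And>i j. i \<in> A \<Longrightarrow> j \<in> A \<Longrightarrow> i \<noteq> j \<Longrightarrow> R i j"
    and N: "\<And>b. b \<in> I - A \<Longrightarrow> N b \<subseteq> A" "\<And>b a. b \<in> I - A \<Longrightarrow> a \<in> N b \<Longrightarrow> R a b"
  shows "(card A choose 3) + (\<Sum>b\<in>I - A. card (N b) choose 2) \<le> card (monotone_triples I R)"
proof -
  define P where "P = {U. U \<subseteq> A \<and> card U = 3}"
  define Q where "Q = (\<lambda>b. insert b ` {W. W \<subseteq> N b \<and> card W = 2})"
  have finA: "finite A" using assms finite_subset by blast
  have finN: "finite (N b)" if "b \<in> I - A" for b using N(1)[OF that] finA finite_subset by blast
  have finQ: "finite (Q b)" if "b \<in> I - A" for b
    unfolding Q_def using finN[OF that] by simp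
  have finP: "finite P" unfolding P_def using finA by simp
  have cardQ: "card (Q b) = card (N b) choose 2" if b: "b \<in> I - A" for b
  proof -
    have "inj_on (insert b) {W. W \<subseteq> N b \<and> card W = 2}"
    proof (rule inj_onI)
      fix W W'
      assume W: "W \<in> {W. W \<subseteq> N b \<and> card W = 2}" "W' \<in> {W. W \<subseteq> N b \<and> card W = 2}"
        and eq: "insert b W = insert b W'"
      have "b \<notin> W" "b \<notin> W'" using W N(1)[OF b] b by auto
      then show "W = W'" using eq by (simp add: insert_ident)
    qed
    then show ?thesis unfolding Q_def by (simp add: card_image n_subsets finN[OF b])
  qed
  \<comment> \<open>The part of a triple outside A reveals b, or is empty for a triple in
    \<open>P\<close>; hence nothing is counted twice.\<close>
  have trace: "U - A = {b}" if "b \<in> I - A" "U \<in> Q b" for U b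
    using that N(1)[OF that(1)] unfolding Q_def by auto
  have disjQ: "Q b \<inter> Q c = {}" if "b \<in> I - A" "c \<in> I - A" "b \<noteq> c" for b c
    using trace that by blast
  have disjP: "P \<inter> (\<Union>b\<in>I - A. Q b) = {}"
  proof -
    have "U - A = {}" if "U \<in> P" for U using that unfolding P_def by auto
    then show ?thesis using trace by fastforce
  qed
  have "(card A choose 3) + (\<Sum>b\<in>I - A. card (N b) choose 2) = card P + card (\<Union>b\<in>I - A. Q b)"
    using fin finQ disjQ by (subst card_UN_disjoint) (auto simp: cardQ P_def n_subsets finA)
  also have "\<dots> = card (P \<union> (\<Union>b\<in>I - A. Q b))"
    using finP fin finQ disjP by (intro card_Un_disjoint[symmetric]) auto
  also have "\<dots> \<le> card (monotone_triples I R)"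
  proof (rule card_mono[OF finite_monotone_triples[OF fin]], rule Un_least)
    show "P \<subseteq> monotone_triples I R"
      using \<open>A \<subseteq> I\<close> RA unfolding P_def monotone_triples_def by blast
    show "(\<Union>b\<in>I - A. Q b) \<subseteq> monotone_triples I R"
    proof (rule UN_least, rule subsetI)
      fix b U assume b: "b \<in> I - A" and "U \<in> Q b"
      then obtain W where W: "W \<subseteq> N b" "card W = 2" and U: "U = insert b W"
        unfolding Q_def by auto
      have WA: "W \<subseteq> A" using W N(1)[OF b] by blast
      then have "finite W" using finA finite_subset by blast
      then have "card U = 3" using W WA b U by (subst U, subst card_insert_disjoint) auto
      moreover have "U \<subseteq> I" using U WA b \<open>A \<subseteq> I\<close> by blast
      moreover have "R i j" if "i \<in> U" "j \<in> U" "i \<noteq> j" for i j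
        using that U W WA N(2)[OF b] RA sym by blast
      ultimately show "U \<in> monotone_triples I R" unfolding monotone_triples_def by blast
    qed
  qed
  finally show ?thesis .
qed

section \<open>Degree sums and the arithmetic of the lower bound\<close>

lemma real_choose_2: "real (n choose 2) = real n * (real n - 1) / 2"
  by (simp add: binomial_gbinomial gbinomial_prod_rev numeral_2_eq_2)

lemma real_choose_3: "real (n choose 3) = real n * (real n - 1) * (real n - 2) / 6"
  by (simp add: binomial_gbinomial gbinomial_prod_rev numeral_3_eq_3)

text \<open>Each pair (a, b) is counted exactly once: at b if \<open>E a b\<close> holds, at a
  otherwise.\<close>

lemma sum_card_bipartite:
  assumes "finite A" "finite B"
  shows "(\<Sum>b\<in>B. card {a\<in>A. E a b}) + (\<Sum>a\<in>A. card {b\<in>B. \<not> E a b}) = card A * card B"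
proof -
  have "(\<Sum>b\<in>B. card {a\<in>A. E a b}) = (\<Sum>b\<in>B. \<Sum>a\<in>A. of_bool (E a b))"
    using assms by (intro sum.cong) (simp_all add: Int_def)
  also have "\<dots> = (\<Sum>a\<in>A. \<Sum>b\<in>B. of_bool (E a b))" by (rule sum.swap)
  also have "\<dots> = (\<Sum>a\<in>A. card {b\<in>B. E a b})"
    using assms by (intro sum.cong) (simp_all add: Int_def)
  finally have "(\<Sum>b\<in>B. card {a\<in>A. E a b}) + (\<Sum>a\<in>A. card {b\<in>B. \<not> E a b})
      = (\<Sum>a\<in>A. card {b\<in>B. E a b} + card {b\<in>B. \<not> E a b})"
    by (simp add: sum.distrib)
  also have "\<dots> = (\<Sum>a\<in>A. card B)"
  proof (rule sum.cong[OF refl])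
    fix a
    have "card ({b\<in>B. E a b} \<union> {b\<in>B. \<not> E a b}) = card {b\<in>B. E a b} + card {b\<in>B. \<not> E a b}"
      using assms by (intro card_Un_disjoint) auto
    moreover have "{b\<in>B. E a b} \<union> {b\<in>B. \<not> E a b} = B" by blast
    ultimately show "card {b\<in>B. E a b} + card {b\<in>B. \<not> E a b} = card B" by simp
  qed
  finally show ?thesis by simp
qed

text \<open>Here p and q stand for the sizes of A and B. The degrees sum to pq, and
  \<open>(p * q)\<^sup>2 / t\<close> is the Cauchy--Schwarz bound for the sum of their squares. For
  p = q the leading term is 1/4 + 3/16 = 7/16 of all triples.\<close>

lemma split_count_ge:
  fixes p q t :: real
  assumes t: "t = p + q" and "t \<ge> 5"
  shows "t * (t - 1) * (t - 2) / 6 * (7/16 - 2/t)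
    \<le> p * (p - 1) * (p - 2) / 6 + q * (q - 1) * (q - 2) / 6 + ((p * q)\<^sup>2 / t - p * q) / 2"
proof -
  define s where "s = p * q"
  have s4: "4 * s \<le> t\<^sup>2"
    using zero_le_power2[of "p - q"] unfolding s_def t by (simp add: power2_eq_square algebra_simps)
  have eq: "p * (p - 1) * (p - 2) / 6 + q * (q - 1) * (q - 2) / 6
      = t^3/6 - t*s/2 - t\<^sup>2/2 + s + t/3"
    unfolding s_def t by (simp add: field_simps power2_eq_square power3_eq_cube)
  have "0 \<le> (t\<^sup>2 - 4*s) * (3*t\<^sup>2 - 4*t - 4*s)"
  proof (rule mult_nonneg_nonneg)
    have "5 * t \<le> t\<^sup>2" using \<open>t \<ge> 5\<close> by (simp add: power2_eq_square)
    then show "0 \<le> 3*t\<^sup>2 - 4*t - 4*s" using s4 \<open>t \<ge> 5\<close> by linarith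
  qed (use s4 in simp)
  moreover have "0 \<le> t * (17 * t\<^sup>2 - 78 * t + 64)"
  proof (rule mult_nonneg_nonneg)
    have "5 * t \<le> t\<^sup>2" using \<open>t \<ge> 5\<close> by (simp add: power2_eq_square)
    then show "0 \<le> 17 * t\<^sup>2 - 78 * t + 64" using \<open>t \<ge> 5\<close> by linarith
  qed (use \<open>t \<ge> 5\<close> in simp)
  \<comment> \<open>The first summand contains the factor t^2 - 4s = (p - q)^2 and vanishes in the
    balanced case; the second is the slack left there by the error term 2/t.\<close>
  moreover have "96 * t * ((t^3/6 - t*s/2 - t\<^sup>2/2 + s + t/3 + (s\<^sup>2/t - s)/2)
      - t * (t - 1) * (t - 2) / 6 * (7/16 - 2/t))
      = 3 * ((t\<^sup>2 - 4*s) * (3*t\<^sup>2 - 4*t - 4*s)) + t * (17 * t\<^sup>2 - 78 * t + 64)"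
    using \<open>t \<ge> 5\<close> by (simp add: field_simps power2_eq_square power3_eq_cube)
  ultimately have "0 \<le> 96 * t * ((t^3/6 - t*s/2 - t\<^sup>2/2 + s + t/3 + (s\<^sup>2/t - s)/2)
      - t * (t - 1) * (t - 2) / 6 * (7/16 - 2/t))"
    by linarith
  then show ?thesis using eq \<open>t \<ge> 5\<close> by (simp add: zero_le_mult_iff s_def)
qed

lemma monotone_triples_label_ge:
  fixes S :: "'a list set"
  assumes fin: "finite S" and t: "card S \<ge> 5" and "x \<noteq> y"
    and mem: "\<And>p. p \<in> S \<Longrightarrow> x \<in> set p \<and> y \<in> set p"
  shows "real (card S choose 3) * (7/16 - 2 / real (card S))
    \<le> real (card (monotone_triples S (\<lambda>p q. label p q x \<le> label p q y)))
      + real (card (monotone_triples S (\<lambda>p q. label p q y \<le> label p q x)))"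
    (is "_ \<le> real ?U + real ?V")
proof -
  define A where "A = {p\<in>S. x \<in> set (before p y)}"
  define B where "B = S - A"
  \<comment> \<open>Ties count as increasing. If \<open>E a b\<close> fails, the label decreases
    strictly from x to y, which suffices for the reverse relation.\<close>
  define E where "E = (\<lambda>p q. label p q x \<le> label p q y)"
  \<comment> \<open>Merging the degrees of both sides into one function on S allows a single use of
    Cauchy--Schwarz, with denominator \<open>card S\<close>.\<close>
  define d where "d = (\<lambda>p. if p \<in> A then card {b\<in>B. \<not> E p b} else card {a\<in>A. E a p})"
  have AS: "A \<subseteq> S" and finA: "finite A" and finB: "finite B" and SAB: "S = A \<union> B" "A \<inter> B = {}"
    and AB: "A = S - B"
    using fin unfolding A_def B_def by auto
  have y_before: "y \<in> set (before p x)" if "p \<in> B" for p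
    using that before_total[of x p y] mem \<open>x \<noteq> y\<close> unfolding A_def B_def by blast
  have cardS: "card S = card A + card B"
    using SAB finA finB by (simp add: card_Un_disjoint)
  have "(card A choose 3) + (\<Sum>b\<in>S - A. card {a\<in>A. E a b} choose 2) \<le> ?U"
    by (rule card_monotone_triples_ge[OF fin AS])
      (auto simp: label_commute E_def A_def intro: less_imp_le label_less)
  moreover have "(card B choose 3) + (\<Sum>a\<in>S - B. card {b\<in>B. \<not> E a b} choose 2) \<le> ?V"
  proof (rule card_monotone_triples_ge[OF fin])
    show "B \<subseteq> S" unfolding B_def by blast
    show "label p q y \<le> label p q x" if "p \<in> B" "q \<in> B" for p q
      using label_less[of y p x q] y_before that by (simp add: less_imp_le)
  qed (auto simp: label_commute E_def)
  moreover have "(\<Sum>b\<in>S - A. card {a\<in>A. E a b} choose 2) + (\<Sum>a\<in>S - B. card {b\<in>B. \<not> E a b} choose 2)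
      = (\<Sum>p\<in>S. d p choose 2)"
    using finA finB SAB unfolding AB[symmetric] B_def[symmetric]
    by (subst SAB(1), subst sum.union_disjoint) (auto simp: d_def intro!: sum.cong)
  ultimately have "(card A choose 3) + (card B choose 3) + (\<Sum>p\<in>S. d p choose 2) \<le> ?U + ?V"
    by linarith
  then have "real ((card A choose 3) + (card B choose 3) + (\<Sum>p\<in>S. d p choose 2)) \<le> real (?U + ?V)"
    by (rule of_nat_mono)
  moreover have "((real (card A) * real (card B))\<^sup>2 / real (card S) - real (card A) * real (card B)) / 2
      \<le> real (\<Sum>p\<in>S. d p choose 2)"
  proof -
    have "(\<Sum>p\<in>S. d p) = (\<Sum>b\<in>B. card {a\<in>A. E a b}) + (\<Sum>a\<in>A. card {b\<in>B. \<not> E a b})"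
      using finA finB SAB by (subst SAB(1), subst sum.union_disjoint) (auto simp: d_def intro!: sum.cong)
    also have "\<dots> = card A * card B" by (rule sum_card_bipartite[OF finA finB])
    finally have D: "(\<Sum>p\<in>S. real (d p)) = real (card A) * real (card B)"
      by (metis of_nat_mult of_nat_sum)
    have "(\<Sum>p\<in>S. real (d p))\<^sup>2 \<le> (\<Sum>p\<in>S. (real (d p))\<^sup>2) * real (card S)"
      by (rule sum_squared_le_sum_of_squares)
    then have "(real (card A) * real (card B))\<^sup>2 / real (card S) \<le> (\<Sum>p\<in>S. (real (d p))\<^sup>2)"
      using t unfolding D by (simp add: divide_le_eq)
    moreover have "real (\<Sum>p\<in>S. d p choose 2) = ((\<Sum>p\<in>S. (real (d p))\<^sup>2) - (\<Sum>p\<in>S. real (d p))) / 2"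
      by (simp add: real_choose_2 sum_subtractf[symmetric] sum_divide_distrib power2_eq_square algebra_simps)
    ultimately show ?thesis unfolding D by simp
  qed
  moreover have "real (card S) * (real (card S) - 1) * (real (card S) - 2) / 6 * (7/16 - 2 / real (card S))
      \<le> real (card A) * (real (card A) - 1) * (real (card A) - 2) / 6
        + real (card B) * (real (card B) - 1) * (real (card B) - 2) / 6
        + ((real (card A) * real (card B))\<^sup>2 / real (card S) - real (card A) * real (card B)) / 2"
    by (rule split_count_ge) (use t in \<open>simp_all add: cardS\<close>)
  ultimately show ?thesis unfolding of_nat_add real_choose_3 by linarith
qed

section \<open>Upper bound for one triple, and double counting\<close>

lemma card_weakly_increasing_pairs:
  "card {(i, j). i \<le> j \<and> j < (n::nat)} = n * (n + 1) div 2"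
proof -
  have "{(i, j). i \<le> j \<and> j < n} = (\<lambda>(j, i). (i, j)) ` (SIGMA j:{..<n}. {..j})" by auto
  then have "card {(i, j). i \<le> j \<and> j < n} = card (SIGMA j:{..<n}. {..j})"
    by (simp add: card_image inj_on_def)
  also have "\<dots> = (\<Sum>j<n. Suc j)" by simp
  also have "\<dots> = n * (n + 1) div 2" by (induction n) auto
  finally show ?thesis .
qed

text \<open>Send (x, y) to the three pairs of labels that the triple gives to x and y. Each is a
  weakly increasing pair below L, and by \<open>labels_inj\<close> the map is injective.\<close>

lemma card_monotone_pairs_le:
  assumes "card U = 3" and "finite X"
    and mem: "\<And>p. p \<in> U \<Longrightarrow> X \<subseteq> set p"
    and L: "\<And>p q. p \<in> U \<Longrightarrow> q \<in> U \<Longrightarrow> p \<noteq> q \<Longrightarrow> LCS p q \<le> L"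
  shows "card {(x, y) \<in> X \<times> X. \<forall>p\<in>U. \<forall>q\<in>U. p \<noteq> q \<longrightarrow> label p q x \<le> label p q y}
    \<le> (L * (L + 1) div 2) ^ 3" (is "card ?M \<le> _")
proof -
  define I where "I = {(i, j). i \<le> j \<and> j < L}"
  obtain p q r where U: "U = {p, q, r}" and d: "p \<noteq> q" "q \<noteq> r" "p \<noteq> r"
    using assms(1) unfolding card_3_iff by blast
  have bound: "label v w x < L" if "v \<in> U" "w \<in> U" "v \<noteq> w" "x \<in> X" for v w x
    using label_less_LCS[of x v w] L mem that by (meson in_mono order_less_le_trans)
  define f where "f = (\<lambda>(x, y). ((label p q x, label p q y),
    (label p r x, label p r y), (label q r x, label q r y)))"
  have "finite I" unfolding I_def by (rule finite_subset[of _ "{..<L} \<times> {..<L}"]) auto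
  have "card ?M \<le> card (I \<times> I \<times> I)"
  proof (rule card_inj_on_le)
    show "f ` ?M \<subseteq> I \<times> I \<times> I"
      using bound d unfolding f_def I_def U by auto
    have eq: "x = y" if "x \<in> X" "y \<in> X" "label p q x = label p q y" "label p r x = label p r y"
      "label q r x = label q r y" for x y
      using labels_inj[of x p y q r] mem that unfolding U by blast
    show "inj_on f ?M"
      unfolding f_def by (intro inj_onI) (auto intro: eq)
  qed (use \<open>finite I\<close> in simp)
  also have "card (I \<times> I \<times> I) = (L * (L + 1) div 2) ^ 3"
    unfolding card_cartesian_product I_def card_weakly_increasing_pairs by (simp add: power3_eq_cube)
  finally show ?thesis .
qed

text \<open>Count the incidences of ordered pairs (x, y) with triples monotone from x to y: from
  below for each pair of letters, from above for each triple.\<close>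

lemma maximal_LCS_bound:
  fixes S :: "'a list set"
  assumes fin: "finite S" "finite X" and t: "card S \<ge> 5"
    and mem: "\<And>p. p \<in> S \<Longrightarrow> X \<subseteq> set p"
    and L: "\<And>p q. p \<in> S \<Longrightarrow> q \<in> S \<Longrightarrow> p \<noteq> q \<Longrightarrow> LCS p q \<le> L"
  shows "(7/4 - 8 / real (card S)) * (real (card X))\<^sup>2 \<le> (real L + 1) ^ 6"
proof -
  define C where "C = card S choose 3"
  define M where "M = (\<lambda>x y. monotone_triples S (\<lambda>p q. label p q x \<le> label p q y))"
  define T where "T = {U. U \<subseteq> S \<and> card U = 3}"
  have finT: "finite T" unfolding T_def using fin by simp
  have cardT: "card T = C" unfolding T_def C_def using fin by (simp add: n_subsets)
  have Cpos: "real C > 0" unfolding C_def using t by simp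
  have pair: "real C * (7/16 - 2 / real (card S)) \<le> real (card (M x y)) + real (card (M y x))"
    if xy: "x \<in> X" "y \<in> X" for x y
  proof (cases "x = y")
    \<comment> \<open>On the diagonal every triple is monotone and is counted twice, so the trivial
      estimate 7/16 \<le> 2 suffices.\<close>
    case True
    then have "M x y = T" unfolding M_def T_def monotone_triples_def by auto
    moreover have "real C * (7/16 - 2 / real (card S)) \<le> real C * 2"
      by (rule mult_left_mono) (auto intro: order_trans[of _ "7/16"])
    ultimately show ?thesis using True cardT by simp
  next
    case False
    then show ?thesis
      using monotone_triples_label_ge[OF fin(1) t False] mem xy unfolding C_def M_def by blast
  qed
  have "(\<Sum>x\<in>X. \<Sum>y\<in>X. card (M x y)) = (\<Sum>x\<in>X. \<Sum>y\<in>X. \<Sum>U\<in>T. of_bool (U \<in> M x y))"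
    using finT by (intro sum.cong) (auto simp: T_def M_def monotone_triples_def intro!: arg_cong[of _ _ card])
  also have "\<dots> = (\<Sum>(x, y)\<in>X \<times> X. \<Sum>U\<in>T. of_bool (U \<in> M x y))"
    by (rule sum.cartesian_product)
  also have "\<dots> = (\<Sum>U\<in>T. \<Sum>(x, y)\<in>X \<times> X. of_bool (U \<in> M x y))"
    unfolding split_def by (rule sum.swap)
  also have "\<dots> \<le> (\<Sum>U\<in>T. (L * (L + 1) div 2) ^ 3)"
  proof (rule sum_mono)
    fix U assume U: "U \<in> T"
    have "(\<Sum>(x, y)\<in>X \<times> X. of_bool (U \<in> M x y)) = card {(x, y) \<in> X \<times> X. U \<in> M x y}"
      using fin(2) by (simp add: split_def Collect_conj_eq[symmetric] Int_def mem_Times_iff)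
    also have "{(x, y) \<in> X \<times> X. U \<in> M x y}
        = {(x, y) \<in> X \<times> X. \<forall>p\<in>U. \<forall>q\<in>U. p \<noteq> q \<longrightarrow> label p q x \<le> label p q y}"
      using U unfolding T_def M_def monotone_triples_def by auto
    also have "card \<dots> \<le> (L * (L + 1) div 2) ^ 3"
    proof (rule card_monotone_pairs_le[OF _ fin(2)])
      show "card U = 3" using U unfolding T_def by blast
      have "U \<subseteq> S" using U unfolding T_def by blast
      then show "X \<subseteq> set p" if "p \<in> U" for p using mem that by blast
      show "LCS p q \<le> L" if "p \<in> U" "q \<in> U" "p \<noteq> q" for p q
        by (rule L) (use \<open>U \<subseteq> S\<close> that in blast)+
    qed
    finally show "(\<Sum>(x, y)\<in>X \<times> X. of_bool (U \<in> M x y)) \<le> (L * (L + 1) div 2) ^ 3" .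
  qed
  finally have "(\<Sum>x\<in>X. \<Sum>y\<in>X. card (M x y)) \<le> C * (L * (L + 1) div 2) ^ 3"
    by (simp add: cardT)
  then have "real (\<Sum>x\<in>X. \<Sum>y\<in>X. card (M x y)) \<le> real (C * (L * (L + 1) div 2) ^ 3)"
    by (rule of_nat_mono)
  also have "\<dots> \<le> real C * ((real L + 1)\<^sup>2 / 2) ^ 3"
  proof -
    have "real (L * (L + 1) div 2) \<le> real (L * (L + 1)) / 2"
      by linarith
    also have "\<dots> \<le> (real L + 1)\<^sup>2 / 2" by (simp add: power2_eq_square algebra_simps)
    finally show ?thesis by (simp add: power_mono mult_left_mono)
  qed
  finally have upper: "(\<Sum>x\<in>X. \<Sum>y\<in>X. real (card (M x y))) \<le> real C * (real L + 1) ^ 6 / 8"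
    by (simp add: power_divide power_mult[symmetric])
  \<comment> \<open>Adding the counts for (x, y) and (y, x) doubles the total, turning the upper
    bound with 1/8 into one with 1/4. Clearing this 1/4 makes 7/16 - 2/t into 7/4 - 8/t.\<close>
  have "(real (card X))\<^sup>2 * (real C * (7/16 - 2 / real (card S)))
      = (\<Sum>x\<in>X. \<Sum>y\<in>X. real C * (7/16 - 2 / real (card S)))"
    by (simp add: power2_eq_square)
  also have "\<dots> \<le> (\<Sum>x\<in>X. \<Sum>y\<in>X. real (card (M x y)) + real (card (M y x)))"
    by (intro sum_mono pair)
  also have "\<dots> = 2 * (\<Sum>x\<in>X. \<Sum>y\<in>X. real (card (M x y)))"
    using sum.swap[of "\<lambda>x y. real (card (M x y))" X X] by (simp add: sum.distrib)
  also have "\<dots> \<le> real C * ((real L + 1) ^ 6 / 4)" using upper by simp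
  finally have "real C * ((real (card X))\<^sup>2 * (7/16 - 2 / real (card S))) \<le> real C * ((real L + 1) ^ 6 / 4)"
    by (simp only: mult.left_commute)
  then have "(real (card X))\<^sup>2 * (7/16 - 2 / real (card S)) \<le> (real L + 1) ^ 6 / 4"
    using Cpos by (simp only: mult_le_cancel_left_pos)
  then show ?thesis by (simp add: algebra_simps)
qed

section \<open>Minimising over sets of permutations\<close>

lemma finite_LCS_pairs: "finite S \<Longrightarrow> finite {LCS p q | p q. p \<in> S \<and> q \<in> S \<and> p \<noteq> q}"
  by (rule finite_subset[of _ "(\<lambda>(p, q). LCS p q) ` (S \<times> S)"]) auto

lemma perms_words_eq: "perms_words k = permutations_of_set {1..k}"
  unfolding perms_words_def permutations_of_set_def by auto

text \<open>The bound \<open>t \<le> fact k\<close> makes the family of t-element sets nonempty, so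
  that \<open>Min\<close> is an attained value and not an unspecified one.\<close>

lemma LCS2_attained:
  assumes "t \<le> fact k"
  obtains S where "S \<subseteq> perms_words k" "card S = t" "LCS2 t k = maxLCS S"
proof -
  let ?P = "{maxLCS S | S. S \<subseteq> perms_words k \<and> card S = t}"
  have fin: "finite (perms_words k)" by (simp add: perms_words_eq)
  then have "finite ?P" by simp
  moreover obtain S where "S \<subseteq> perms_words k" "card S = t"
    using obtain_subset_with_card_n[of t "perms_words k"] assms by (auto simp: perms_words_eq)
  then have "?P \<noteq> {}" by blast
  ultimately have "LCS2 t k \<in> ?P" unfolding LCS2_def by (rule Min_in)
  then show ?thesis using that by blast
qed

theorem theorem7:
  fixes t k :: nat
  assumes "t \<ge> 5" and "k \<ge> 1" and "t \<le> fact k"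
  shows "real (LCS2 t k) \<ge> (7/4 - 8 / real t) powr (1/6) * real k powr (1/3) - 2"
proof -
  obtain S where S: "S \<subseteq> perms_words k" "card S = t" "LCS2 t k = maxLCS S"
    using LCS2_attained assms(3) .
  define L where "L = maxLCS S"
  define c where "c = 7/4 - 8 / real t"
  \<comment> \<open>Since 8/5 < 7/4, the constant c is nonnegative, as needed for taking sixth
    roots.\<close>
  have "8 / real t \<le> 8 / 5" using assms(1) by (intro divide_left_mono) auto
  then have c: "c \<ge> 0" unfolding c_def by simp
  have finS: "finite S" using S(1) by (rule finite_subset) (simp add: perms_words_eq)
  have "(7/4 - 8 / real (card S)) * (real (card {1..k}))\<^sup>2 \<le> (real L + 1) ^ 6"
  proof (rule maximal_LCS_bound[OF finS])
    show "{1..k} \<subseteq> set p" if "p \<in> S" for p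
      using that S(1) unfolding perms_words_def by blast
    show "LCS p q \<le> L" if "p \<in> S" "q \<in> S" "p \<noteq> q" for p q
      unfolding L_def maxLCS_def by (rule Max_ge[OF finite_LCS_pairs[OF finS]]) (use that in blast)
  qed (use S assms in auto)
  then have "c * (real k)\<^sup>2 \<le> (real L + 1) ^ 6" using S(2) by (simp add: c_def)
  then have "(c * (real k)\<^sup>2) powr (1/6) \<le> ((real L + 1) ^ 6) powr (1/6)"
    using c by (intro powr_mono2) auto
  moreover have "((real L + 1) ^ 6) powr (1/6) = real L + 1"
  proof -
    have "(real L + 1) ^ 6 = (real L + 1) powr 6" by simp
    then show ?thesis by (simp only: powr_powr) simp
  qed
  moreover have "(c * (real k)\<^sup>2) powr (1/6) = c powr (1/6) * real k powr (1/3)"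
  proof -
    have "(real k)\<^sup>2 = real k powr 2" using assms(2) by simp
    then have "((real k)\<^sup>2) powr (1/6) = real k powr (1/3)" by (simp only: powr_powr) simp
    then show ?thesis using c by (simp add: powr_mult)
  qed
  \<comment> \<open>The sixth root bounds L + 1 from below, which gives the estimate even with -1 in
    place of -2.\<close>
  ultimately show ?thesis unfolding c_def L_def S(3) by simp
qed

end
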